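(* Let $H_n$ denote $\mathbb{R}^n$ or $\mathbb{C}^n$ with $n\ge2$. Let $F=\{f_i\}_{i\in I}\subseteq H_n\setminus\{0\}$ be a tight frame with $|I|=k$ and factor poset $\mathbb{F}_F$. Then $$|\mathbb{F}_F|\le\begin{cases}\binom{k}{k/2}, & k\text{ is even},\\[2pt] 2\binom{k-1}{\lfloor k/2\rfloor-1}, & k\text{ is odd}.\end{cases}$$ Moreover, this bound is tight for $n=2$ and not tight for $n\ge3$.
   Context: A frame for $H_n$ is a finite sequence $\{f_i\}_{i\in I}$ (repetitions allowed) spanning $H_n$. It is tight if there is $\lambda>0$ with $\sum_{i\in I}|\langle x,f_i\rangle|^2=\lambda\|x\|^2$ for all $x\in H_n$. The factor poset of a frame $F=\{f_i\}_{i\in I}$ is $\mathbb{F}_F=\{J\subseteq I:\{f_j\}_{j\in J}\text{ is a tight frame for }H_n\}$, ordered by inclusion, with the convention $\emptyset\in\mathbb{F}_F$. In the last sentence of the claim, "tight" is said of the bound, in the sense of the bound being attained, and not of frames.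
   Formalization: For n≥3 the bound is shown not to be attained for any k other than 3; k=3 is excluded because for n=k=3 the bound equals 2 and is attained by an orthonormal basis of H_3, while for n≥4 no frame with k=3 vectors exists. *)

theory Defs
  imports "HOL-Analysis.Analysis"
begin

text \<open>
  The space \<open>H\<^sub>n\<close> is \<^typ>\<open>real ^ 'n\<close> or \<^typ>\<open>complex ^ 'n\<close> with \<open>n = CARD('n)\<close>. A finite sequence
  with repetitions is a family \<open>f\<close> together with a finite index set. The inner product is a
  parameter \<open>ip\<close>: it is \<^const>\<open>inner\<close> on \<^typ>\<open>real ^ 'n\<close>, and \<open>hermitian_inner\<close> on
  \<^typ>\<open>complex ^ 'n\<close>, where \<^const>\<open>inner\<close> would only be the real part of the Hermitian product.
\<close>

definition hermitian_inner :: "complex ^ 'n \<Rightarrow> complex ^ 'n \<Rightarrow> complex" where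
  "hermitian_inner x y = (\<Sum>i\<in>UNIV. x $ i * cnj (y $ i))"

text \<open>\<open>vec.span\<close> is the span over the scalar field \<open>'a\<close>, not over the reals.\<close>

definition is_frame :: "'i set \<Rightarrow> ('i \<Rightarrow> 'a::field ^ 'n) \<Rightarrow> bool" where
  "is_frame I f \<longleftrightarrow> finite I \<and> vec.span (f ` I) = UNIV"

definition is_tight_frame ::
  "('a::real_normed_field ^ 'n \<Rightarrow> 'a ^ 'n \<Rightarrow> 'a) \<Rightarrow> 'i set \<Rightarrow> ('i \<Rightarrow> 'a ^ 'n) \<Rightarrow> bool" where
  "is_tight_frame ip I f \<longleftrightarrow>
     is_frame I f \<and> (\<exists>c>0. \<forall>x. (\<Sum>i\<in>I. (norm (ip x (f i)))\<^sup>2) = c * (norm x)\<^sup>2)"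

definition factor_poset ::
  "('a::real_normed_field ^ 'n \<Rightarrow> 'a ^ 'n \<Rightarrow> 'a) \<Rightarrow> 'i set \<Rightarrow> ('i \<Rightarrow> 'a ^ 'n) \<Rightarrow> 'i set set" where
  "factor_poset ip I f = {J. J \<subseteq> I \<and> (J = {} \<or> is_tight_frame ip J f)}"

text \<open>
  Truncated subtraction only matters for \<open>k \<le> 1\<close>; a frame for \<open>H\<^sub>n\<close> with \<open>n \<ge> 2\<close> has \<open>k \<ge> n \<ge> 2\<close>.
\<close>

definition factor_poset_bound :: "nat \<Rightarrow> nat" where
  "factor_poset_bound k =
     (if even k then k choose (k div 2) else 2 * ((k - 1) choose (k div 2 - 1)))"

text \<open>
  The case \<open>k = 3\<close> is exceptional for \<open>n = 3\<close>: the bound is then \<open>2\<close>, and an orthonormal basis of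
  \<open>H\<^sub>3\<close>, whose factor poset consists of the empty set and the whole index set, attains it.
\<close>

definition factor_poset_bound_attained ::
  "('a::real_normed_field ^ 'n \<Rightarrow> 'a ^ 'n \<Rightarrow> 'a) \<Rightarrow> nat \<Rightarrow> bool" where
  "factor_poset_bound_attained ip k \<longleftrightarrow>
     (\<exists>f :: nat \<Rightarrow> 'a ^ 'n. is_tight_frame ip {..<k} f \<and> (\<forall>i<k. f i \<noteq> 0) \<and>
        card (factor_poset ip {..<k} f) = factor_poset_bound k)"

end

theory Submission
  imports Defs
begin

text \<open>
  If \<open>x\<close> and \<open>y\<close> have equal norm, the numbers \<open>\<bar>\<langle>x, f\<^sub>i\<rangle>\<bar>\<^sup>2 - \<bar>\<langle>y, f\<^sub>i\<rangle>\<bar>\<^sup>2\<close> sum to zero over every tight subfamily. A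
  generic linear combination of such functionals gives reals \<open>a\<^sub>i \<noteq> 0\<close> summing to zero over all factors.
  With \<open>N\<close> the set of indices with \<open>a\<^sub>i < 0\<close>, the map \<open>J \<mapsto> J \<triangle> N\<close> takes the zero-sum sets to the sets
  whose weight with respect to \<open>\<bar>a\<^sub>i\<bar>\<close> is half of the total. In a cyclic order of the indices, the arcs of
  half weight come from a matching on the \<open>k\<close> cut points, so there are at most \<open>2\<lfloor>k/2\<rfloor>\<close> of them, and
  averaging over all orders as in Katona's proof of the Erdos-Ko-Rado theorem gives the bound.

  If \<open>n \<ge> 3\<close>, \<open>k \<ge> 4\<close> and the bound is attained, all zero-sum sets are factors, hence have at least three
  elements, and every cyclic order has exactly \<open>2\<lfloor>k/2\<rfloor>\<close> half-weight arcs. An order in which \<open>N\<close> is an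
  arc violates this. For \<open>n = 2\<close> equality holds for vectors on the two axes with suitable lengths.
\<close>

subsection \<open>Permutations mapping a set to another\<close>

text \<open>A bijection from \<open>K\<close> to \<open>L\<close> is glued to one between their
  complements in \<open>I\<close>, which also have equal size.\<close>

lemma ex_permutes_image_eq:
  assumes "finite I" "K \<subseteq> I" "L \<subseteq> I" "card K = card L"
  obtains p where "p permutes I" "p ` K = L"
proof -
  have fin: "finite K" "finite L" using assms finite_subset by auto
  obtain f where f: "bij_betw f K L"
    using fin assms(4) by (meson finite_same_card_bij)
  have "card (I - K) = card (I - L)"
    using assms fin by (simp add: card_Diff_subset)
  then obtain g where g: "bij_betw g (I - K) (I - L)"
    using assms(1) by (meson finite_Diff finite_same_card_bij)
  define p where "p x = (if x \<in> K then f x else if x \<in> I then g x else x)" for x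
  have pK: "bij_betw p K L" using f by (simp add: p_def cong: bij_betw_cong)
  have "bij_betw p (I - K) (I - L)"
    using g by (rule iffD1[OF bij_betw_cong, rotated]) (simp add: p_def)
  then have "bij_betw p (K \<union> (I - K)) (L \<union> (I - L))"
    using pK by (intro bij_betw_combine) auto
  moreover have "K \<union> (I - K) = I" "L \<union> (I - L) = I" using assms by auto
  ultimately have "p permutes I"
    using assms(2) by (intro bij_imp_permutes) (auto simp: p_def)
  moreover have "p ` K = L" using pK by (simp add: bij_betw_def)
  ultimately show ?thesis using that by blast
qed

text \<open>Composing with a permutation that takes \<open>L\<close> to \<open>K\<close> matches the
  permutations sending \<open>T\<close> to \<open>L\<close> with those sending \<open>T\<close> to
  \<open>K\<close>. All permutations are therefore spread evenly over the possible images, the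
  subsets of size \<open>card K\<close>.\<close>

lemma card_permutes_image_eq:
  assumes "finite I" "T \<subseteq> I" "K \<subseteq> I" "card T = card K"
  shows "real (card {p. p permutes I \<and> p ` T = K}) = fact (card I) / (card I choose card K)"
proof -
  let ?r = "card K"
  let ?P = "\<lambda>L. {p. p permutes I \<and> p ` T = L}"
  let ?S = "{L. L \<subseteq> I \<and> card L = ?r}"
  have finP: "finite {p. p permutes I}" using assms(1) by (rule finite_permutations)
  have eq: "card (?P L) = card (?P K)" if L: "L \<in> ?S" for L
  proof -
    have "card K = card L" using L by simp
    then obtain q where q: "q permutes I" "q ` L = K"
      using ex_permutes_image_eq[OF assms(1), of L K] L assms(3) by auto
    have "bij_betw (\<lambda>p. q \<circ> p) (?P L) (?P K)"
    proof (rule bij_betw_byWitness[where f' = "\<lambda>p. inv q \<circ> p"])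
      show "\<forall>p\<in>?P L. inv q \<circ> (q \<circ> p) = p" "\<forall>p\<in>?P K. q \<circ> (inv q \<circ> p) = p"
        using q(1) by (auto simp: o_assoc permutes_inv_o)
      show "(\<circ>) q ` ?P L \<subseteq> ?P K"
        using q by (auto simp: image_comp[symmetric] intro: permutes_compose)
      have "inv q ` K = L"
        using q by (metis image_inv_f_f permutes_inj)
      then show "(\<circ>) (inv q) ` ?P K \<subseteq> ?P L"
        using q by (auto simp: image_comp[symmetric] intro: permutes_compose permutes_inv)
    qed
    then show ?thesis by (rule bij_betw_same_card)
  qed
  have "{p. p permutes I} = (\<Union>L\<in>?S. ?P L)"
  proof (intro equalityI subsetI)
    fix p assume "p \<in> {p. p permutes I}"
    then have p: "p permutes I" by simp
    then have "p ` T \<subseteq> I" "card (p ` T) = ?r"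
      using assms(2,4) permutes_image[OF p] by (auto simp: card_image permutes_inj_on)
    with p show "p \<in> (\<Union>L\<in>?S. ?P L)" by blast
  qed auto
  then have "fact (card I) = card (\<Union>L\<in>?S. ?P L)"
    using card_permutations[OF refl assms(1)] by simp
  also have "\<dots> = (\<Sum>L\<in>?S. card (?P L))"
    using assms(1) finP by (intro card_UN_disjoint) auto
  also have "\<dots> = (\<Sum>L\<in>?S. card (?P K))" using eq by (intro sum.cong) auto
  also have "\<dots> = (card I choose ?r) * card (?P K)" by (simp add: n_subsets[OF assms(1)])
  finally have "real (fact (card I)) = real (card I choose ?r) * real (card (?P K))"
    by (metis of_nat_mult)
  moreover have "card I choose ?r \<noteq> 0"
    using assms card_mono[OF assms(1,3)] by simp
  ultimately show ?thesis by (simp add: field_simps)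
qed

lemma sum_of_bool_eq_card:
  "finite A \<Longrightarrow> (\<Sum>x\<in>A. of_bool (P x)) = real (card {x \<in> A. P x})"
  by (simp add: Int_def)

text \<open>Counts the positions of an arc of length \<open>r\<close> that avoids the last gap: it
  may start at any of \<open>0, ..., k - r - 1\<close>.\<close>

lemma card_pairs_diff_eq:
  fixes k r :: nat
  assumes "0 < r"
  shows "card {q \<in> {(s, e). s < e \<and> e < k}. snd q - fst q = r} = k - r"
proof -
  have "{q \<in> {(s, e). s < e \<and> e < k}. snd q - fst q = r} = (\<lambda>s. (s, s + r)) ` {..<k - r}"
    using assms by (auto simp: image_iff)
  then show ?thesis by (simp add: card_image inj_on_def)
qed

subsection \<open>Arcs of half the total weight\<close>

text \<open>
  Among the points \<open>0, \<dots>, k - 1\<close> of a cyclic order, the pairs cutting the circle into two arcs of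
  equal weight form a matching. Only the arc avoiding the last gap is recorded.
\<close>

definition half_arcs :: "('i \<Rightarrow> real) \<Rightarrow> nat \<Rightarrow> real \<Rightarrow> (nat \<Rightarrow> 'i) \<Rightarrow> (nat \<times> nat) set" where
  "half_arcs b k t h = {(s, e). s < e \<and> e < k \<and> sum b (h ` {s..<e}) = t}"

lemma finite_half_arcs [simp]: "finite (half_arcs b k t h)"
  by (rule finite_subset[of _ "{..<k} \<times> {..<k}"]) (auto simp: half_arcs_def)

locale half_arcs_weights =
  fixes I :: "'i set" and b :: "'i \<Rightarrow> real" and k :: nat and t :: real and h :: "nat \<Rightarrow> 'i"
  assumes pos: "\<And>i. i \<in> I \<Longrightarrow> b i > 0"
    and bij: "bij_betw h {..<k} I"
    and total: "sum b I = 2 * t"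
begin

text \<open>Prefix sums turn the recorded arcs of half weight into pairs of cut points at distance
  \<open>t\<close> on the real line.\<close>

definition B :: "nat \<Rightarrow> real" where "B s = (\<Sum>j<s. b (h j))"

lemma h_in: "j < k \<Longrightarrow> h j \<in> I"
  using bij by (auto dest: bij_betwE)

lemma sum_arc: "s \<le> e \<Longrightarrow> e \<le> k \<Longrightarrow> sum b (h ` {s..<e}) = B e - B s"
proof -
  assume "s \<le> e" "e \<le> k"
  then have "sum b (h ` {s..<e}) = (\<Sum>j\<in>{s..<e}. b (h j))"
    using bij by (intro sum.reindex_cong[OF _ refl]) (auto simp: bij_betw_def inj_on_def)
  moreover have "B e = B s + (\<Sum>j\<in>{s..<e}. b (h j))"
    using \<open>s \<le> e\<close> unfolding B_def
    by (metis lessThan_atLeast0 sum.atLeastLessThan_concat zero_le)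
  ultimately show ?thesis by simp
qed

lemma B_less: "s < e \<Longrightarrow> e \<le> k \<Longrightarrow> B s < B e"
proof -
  assume "s < e" "e \<le> k"
  then have "0 < sum b (h ` {s..<e})"
    by (intro sum_pos) (auto intro!: pos h_in)
  then show ?thesis using sum_arc \<open>s < e\<close> \<open>e \<le> k\<close> by simp
qed

lemma B_less_iff: "s \<le> k \<Longrightarrow> e \<le> k \<Longrightarrow> B s < B e \<longleftrightarrow> s < e"
  by (metis B_less less_asym linorder_neqE_nat less_irrefl)

lemma B_eq_iff: "s \<le> k \<Longrightarrow> e \<le> k \<Longrightarrow> B s = B e \<longleftrightarrow> s = e"
  by (metis B_less less_irrefl linorder_neqE_nat)

lemma B_0: "B 0 = 0" by (simp add: B_def)

lemma B_k: "B k = 2 * t"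
  using sum_arc[of 0 k] bij total by (simp add: B_0 bij_betw_def lessThan_atLeast0)

text \<open>Since \<open>e < k\<close>, positivity gives \<open>B e < B k = 2 * t\<close> and hence
  \<open>B s < t\<close>. The value \<open>t\<close> thus separates starting points from end
  points.\<close>

lemma half_arcs_D:
  assumes "(s, e) \<in> half_arcs b k t h"
  shows "s < e" "e < k" "B e = B s + t" "B s < t" "t \<le> B e"
proof -
  show 1: "s < e" "e < k" "B e = B s + t"
    using assms sum_arc[of s e] by (auto simp: half_arcs_def)
  show "B s < t" using B_less[of e k] 1 B_k by simp
  have "B 0 \<le> B s" using B_less[of 0 s] 1 by (cases "s = 0") auto
  then show "t \<le> B e" using 1 B_0 by simp
qed

lemma inj_on_fst_half_arcs: "inj_on fst (half_arcs b k t h)"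
proof (rule inj_onI, clarsimp)
  fix s e e' assume "(s, e) \<in> half_arcs b k t h" "(s, e') \<in> half_arcs b k t h"
  then show "e = e'"
    using half_arcs_D B_eq_iff[of e e'] by (metis less_imp_le_nat)
qed

lemma inj_on_snd_half_arcs: "inj_on snd (half_arcs b k t h)"
proof (rule inj_onI, clarsimp)
  fix s s' e assume "(s, e) \<in> half_arcs b k t h" "(s', e) \<in> half_arcs b k t h"
  from this[THEN half_arcs_D(3)] this[THEN half_arcs_D(1)] this[THEN half_arcs_D(2)]
  have "B s = B s'" "s < e" "s' < e" "e < k" by auto
  then show "s = s'" using B_eq_iff[of s s'] by simp
qed

text \<open>A start determines its end and conversely, because \<open>B\<close> is strictly
  increasing, and no point is both a start and an end. Each arc therefore uses up two of the
  \<open>k\<close> cut points.\<close>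

lemma card_half_arcs_le: "card (half_arcs b k t h) \<le> k div 2"
proof -
  let ?M = "half_arcs b k t h"
  have "B s < t" if "s \<in> fst ` ?M" for s using that half_arcs_D(4) by auto
  moreover have "t \<le> B s" if "s \<in> snd ` ?M" for s using that half_arcs_D(5) by auto
  ultimately have "fst ` ?M \<inter> snd ` ?M = {}" by (meson disjoint_iff not_le)
  then have "card (fst ` ?M \<union> snd ` ?M) = 2 * card ?M"
    by (simp add: card_Un_disjoint card_image inj_on_fst_half_arcs inj_on_snd_half_arcs)
  moreover have "card (fst ` ?M \<union> snd ` ?M) \<le> card {..<k}"
    by (rule card_mono) (auto dest: half_arcs_D(1,2) intro: less_trans[OF half_arcs_D(1) half_arcs_D(2)])
  ultimately show ?thesis by simp
qed

section \<open>Averaging over all orders\<close>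

definition half_sets :: "'i set set" where "half_sets = {K. K \<subseteq> I \<and> sum b K = t}"

lemma finite_I: "finite I" using bij bij_betw_finite by blast

lemma card_I: "card I = k" using bij bij_betw_same_card by fastforce

lemma finite_half_sets: "finite half_sets"
  unfolding half_sets_def using finite_I by simp

lemma compl_half_sets: "K \<in> half_sets \<Longrightarrow> I - K \<in> half_sets"
  using finite_I total by (auto simp: half_sets_def sum_diff)

lemma permuted: "p permutes I \<Longrightarrow> half_arcs_weights I b k t (p \<circ> h)"
  using pos bij total permutes_imp_bij by unfold_locales (auto intro: bij_betw_trans)

text \<open>Double counting of triples of an order \<open>p\<close>, a pair \<open>q\<close> and a
  set \<open>K\<close> such that \<open>p\<close> carries the arc of \<open>q\<close> onto
  \<open>K\<close>. A fixed \<open>K\<close> has \<open>k - card K\<close> possible positions, and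
  each is carried onto \<open>K\<close> by \<open>fact k / (k choose card K)\<close>
  permutations.\<close>

lemma sum_card_half_arcs:
  assumes "I \<noteq> {}"
  shows "(\<Sum>p | p permutes I. real (card (half_arcs b k t (p \<circ> h)))) =
    (\<Sum>K\<in>half_sets. real (k - card K) * (fact k / (k choose card K)))"
proof -
  let ?Q = "{(s, e). s < e \<and> e < k}"
  let ?arc = "\<lambda>q. h ` {fst q..<snd q}"
  have finQ: "finite ?Q" by (rule finite_subset[of _ "{..<k} \<times> {..<k}"]) auto
  have finP: "finite {p. p permutes I}" using finite_I by (rule finite_permutations)
  have arcI: "?arc q \<subseteq> I" "card (?arc q) = snd q - fst q" if "q \<in> ?Q" for q
  proof -
    have "{fst q..<snd q} \<subseteq> {..<k}" using that by auto
    then show "?arc q \<subseteq> I" "card (?arc q) = snd q - fst q"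
      using bij by (auto simp: bij_betw_def card_image inj_on_subset)
  qed
  \<comment> \<open>Positivity keeps the empty set out of \<open>half_sets\<close>; it could not be
    an arc with \<open>s < e\<close>.\<close>
  have t: "t > 0" using sum_pos[OF finite_I assms, of b] pos total by simp
  have 1: "real (card (half_arcs b k t (p \<circ> h))) =
      (\<Sum>q\<in>?Q. \<Sum>K\<in>half_sets. of_bool (p ` ?arc q = K))" if "p permutes I" for p
  proof -
    have "p ` ?arc q \<in> half_sets \<longleftrightarrow> sum b (p ` ?arc q) = t" if "q \<in> ?Q" for q
      using arcI[OF that] permutes_image[OF \<open>p permutes I\<close>] by (auto simp: half_sets_def)
    then have "half_arcs b k t (p \<circ> h) = {q \<in> ?Q. p ` ?arc q \<in> half_sets}"
      by (auto simp: half_arcs_def image_comp)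
    then have "real (card (half_arcs b k t (p \<circ> h))) = (\<Sum>q\<in>?Q. of_bool (p ` ?arc q \<in> half_sets))"
      by (simp only: sum_of_bool_eq_card[OF finQ])
    also have "\<dots> = (\<Sum>q\<in>?Q. \<Sum>K\<in>half_sets. of_bool (p ` ?arc q = K))"
      using finite_half_sets by (intro sum.cong refl) (simp add: of_bool_def)
    finally show ?thesis .
  qed
  have 2: "(\<Sum>p | p permutes I. of_bool (p ` ?arc q = K)) =
      of_bool (snd q - fst q = card K) * (fact k / real (k choose card K))"
    if "q \<in> ?Q" "K \<in> half_sets" for q K
  proof (cases "snd q - fst q = card K")
    case True
    have "(\<Sum>p | p permutes I. of_bool (p ` ?arc q = K)) =
        real (card {p. p permutes I \<and> p ` ?arc q = K})"
      by (simp only: sum_of_bool_eq_card[OF finP] mem_Collect_eq)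
    also have "\<dots> = fact k / real (k choose card K)"
      using card_permutes_image_eq[OF finite_I, of "?arc q" K] arcI[OF that(1)] that(2) True
      by (simp add: half_sets_def card_I)
    finally show ?thesis using True by simp
  next
    case False
    have "p ` ?arc q \<noteq> K" if "p permutes I" for p
    proof
      assume "p ` ?arc q = K"
      then have "card K = card (?arc q)" using card_image[OF permutes_inj_on[OF that]] by blast
      with False arcI(2)[OF \<open>q \<in> ?Q\<close>] show False by simp
    qed
    then have "of_bool (p ` ?arc q = K) = (0 :: real)" if "p permutes I" for p
      using that by (simp only: of_bool_eq)
    then show ?thesis using False by (simp only: sum.neutral mem_Collect_eq) simp
  qed
  have 3: "(\<Sum>q\<in>?Q. of_bool (snd q - fst q = card K)) = real (k - card K)"
    if "K \<in> half_sets" for K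
  proof -
    have "K \<noteq> {}" "finite K" using that t finite_I finite_subset by (auto simp: half_sets_def)
    then have "0 < card K" by (simp add: card_gt_0_iff)
    from card_pairs_diff_eq[OF this, of k] show ?thesis
      by (simp only: sum_of_bool_eq_card[OF finQ])
  qed
  have "(\<Sum>p | p permutes I. real (card (half_arcs b k t (p \<circ> h)))) =
      (\<Sum>p | p permutes I. \<Sum>q\<in>?Q. \<Sum>K\<in>half_sets. of_bool (p ` ?arc q = K))"
    by (intro sum.cong) (simp_all add: 1)
  also have "\<dots> = (\<Sum>q\<in>?Q. \<Sum>p | p permutes I. \<Sum>K\<in>half_sets. of_bool (p ` ?arc q = K))"
    by (rule sum.swap)
  also have "\<dots> = (\<Sum>q\<in>?Q. \<Sum>K\<in>half_sets. \<Sum>p | p permutes I. of_bool (p ` ?arc q = K))"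
    by (intro sum.cong refl sum.swap)
  also have "\<dots> = (\<Sum>K\<in>half_sets. \<Sum>q\<in>?Q. \<Sum>p | p permutes I. of_bool (p ` ?arc q = K))"
    by (rule sum.swap)
  also have "\<dots> = (\<Sum>K\<in>half_sets. (\<Sum>q\<in>?Q. of_bool (snd q - fst q = card K)) * (fact k / (k choose card K)))"
    unfolding sum_distrib_right by (intro sum.cong refl 2)
  also have "\<dots> = (\<Sum>K\<in>half_sets. real (k - card K) * (fact k / (k choose card K)))"
    by (intro sum.cong refl) (simp only: 3)
  finally show ?thesis .
qed

text \<open>Complementation permutes \<open>half_sets\<close>, exchanges \<open>card K\<close> with
  \<open>k - card K\<close> and preserves the binomial coefficient. Adding the two forms of the sum
  makes the weights \<open>k - card K\<close> and \<open>card K\<close> combine to \<open>k\<close>,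
  which accounts for the arcs through the last gap.\<close>

lemma sum_half_sets_compl:
  "2 * (\<Sum>K\<in>half_sets. real (k - card K) * (fact k / (k choose card K))) =
    (\<Sum>K\<in>half_sets. real k * (fact k / (k choose card K)))"
proof -
  have sub: "K \<subseteq> I" "card K \<le> k" "card (I - K) = k - card K" if "K \<in> half_sets" for K
    using that card_mono[OF finite_I, of K] card_Diff_subset[of K I] finite_I
    by (auto simp: half_sets_def card_I finite_subset)
  have "(\<Sum>K\<in>half_sets. real (k - card K) * (fact k / (k choose card K))) =
      (\<Sum>K\<in>half_sets. real (card K) * (fact k / (k choose card K)))"
    by (rule sum.reindex_bij_witness[of _ "\<lambda>K. I - K" "\<lambda>K. I - K"])
      (use sub compl_half_sets in \<open>auto simp: double_diff binomial_symmetric[symmetric]\<close>)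
  then have "2 * (\<Sum>K\<in>half_sets. real (k - card K) * (fact k / (k choose card K))) =
      (\<Sum>K\<in>half_sets. real (k - card K) * (fact k / (k choose card K)) +
        real (card K) * (fact k / (k choose card K)))"
    by (simp add: sum.distrib)
  also have "\<dots> = (\<Sum>K\<in>half_sets. real k * (fact k / (k choose card K)))"
    using sub(2) by (intro sum.cong refl) (simp add: of_nat_diff flip: distrib_right add_divide_distrib)
  finally show ?thesis .
qed

text \<open>
  Counted with complements, a set \<open>K\<close> is an arc of a proportion \<open>k / (k choose card K)\<close> of the orders,
  which is smallest for the middle size.
\<close>

lemma card_half_sets:
  assumes "I \<noteq> {}"
  shows "card half_sets * k \<le> 2 * (k div 2) * (k choose (k div 2))" (is ?le)
    and "card (half_arcs b k t h) < k div 2 \<Longrightarrow>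
      card half_sets * k < 2 * (k div 2) * (k choose (k div 2))" (is "_ \<Longrightarrow> ?less")
proof -
  let ?c = "real (k choose (k div 2))"
  let ?S = "\<Sum>p | p permutes I. real (card (half_arcs b k t (p \<circ> h)))"
  have finP: "finite {p. p permutes I}" using finite_I by (rule finite_permutations)
  have cardP: "card {p. p permutes I} = fact k"
    using card_permutations[OF refl finite_I] by (simp add: card_I)
  have c: "?c > 0" by (simp add: zero_less_binomial_iff)
  have le: "card (half_arcs b k t (p \<circ> h)) \<le> k div 2" if "p permutes I" for p
    using half_arcs_weights.card_half_arcs_le[OF permuted[OF that]] .
  have "real (card half_sets) * (real k * (fact k / ?c)) = (\<Sum>K\<in>half_sets. real k * (fact k / ?c))"
    by simp
  also have "\<dots> \<le> (\<Sum>K\<in>half_sets. real k * (fact k / (k choose card K)))"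
  proof (intro sum_mono mult_left_mono divide_left_mono mult_pos_pos)
    fix K assume "K \<in> half_sets"
    then have "card K \<le> k" using card_mono[OF finite_I] by (auto simp: half_sets_def card_I)
    then show "0 < real (k choose card K)" by (simp add: zero_less_binomial_iff)
  qed (use c binomial_maximum in auto)
  also have "\<dots> = 2 * ?S"
    by (simp only: sum_half_sets_compl[symmetric] sum_card_half_arcs[OF assms])
  finally have *: "real (card half_sets) * (real k * (fact k / ?c)) \<le> 2 * ?S" .
  have "?S \<le> (\<Sum>p | p permutes I. real (k div 2))"
    using le by (intro sum_mono) auto
  then have "2 * ?S \<le> 2 * (fact k * real (k div 2))" by (simp add: cardP)
  with * have "real (card half_sets) * (real k * (fact k / ?c)) \<le> 2 * (fact k * real (k div 2))"
    by linarith
  then have "real (card half_sets) * real k \<le> 2 * real (k div 2) * ?c"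
    using c by (simp add: field_simps)
  then show ?le by (metis (mono_tags) of_nat_le_iff of_nat_mult of_nat_numeral)
  assume less: "card (half_arcs b k t h) < k div 2"
  \<comment> \<open>No order exceeds \<open>k div 2\<close>, and the identity, which stands for
    \<open>h\<close> itself, stays below it; one such order makes the average strict.\<close>
  have "?S < (\<Sum>p | p permutes I. real (k div 2))"
    using le less finP by (intro sum_strict_mono_ex1) (auto intro!: exI[of _ id] permutes_id)
  then have "2 * ?S < 2 * (fact k * real (k div 2))" by (simp add: cardP)
  with * have "real (card half_sets) * (real k * (fact k / ?c)) < 2 * (fact k * real (k div 2))"
    by linarith
  then have "real (card half_sets) * real k < 2 * real (k div 2) * ?c"
    using c by (simp add: field_simps)
  then show ?less by (metis (mono_tags) of_nat_less_iff of_nat_mult of_nat_numeral)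
qed

end

text \<open>Brings both parities into the form produced by the averaging argument. The factor
  \<open>k\<close> avoids division; the odd case is the absorption identity for binomial
  coefficients.\<close>

lemma factor_poset_bound_times:
  assumes "2 \<le> k"
  shows "factor_poset_bound k * k = 2 * (k div 2) * (k choose (k div 2))"
proof (cases "even k")
  case True
  then show ?thesis by (simp add: factor_poset_bound_def)
next
  case False
  then have "k = Suc (2 * Suc (k div 2 - 1))" using assms by presburger
  then obtain m where m: "k = Suc (2 * Suc m)" by blast
  have *: "k * ((k - 1) choose m) = Suc m * (k choose Suc m)"
    by (rule binomial_absorption[symmetric])
  have half: "k div 2 = Suc m" using m by simp
  have "factor_poset_bound k * k = 2 * (k * ((k - 1) choose m))"
    using False by (simp add: factor_poset_bound_def half)
  also have "\<dots> = 2 * (k div 2) * (k choose (k div 2))"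
    by (simp only: * half mult.assoc refl)
  finally show ?thesis .
qed

subsection \<open>Zero-sum subsets\<close>

definition zero_sum_sets :: "'i set \<Rightarrow> ('i \<Rightarrow> real) \<Rightarrow> 'i set set" where
  "zero_sum_sets I a = {J. J \<subseteq> I \<and> sum a J = 0}"

lemma finite_zero_sum_sets: "finite I \<Longrightarrow> finite (zero_sum_sets I a)"
  by (simp add: zero_sum_sets_def)

lemma zero_sum_sets_uminus: "zero_sum_sets I (\<lambda>i. - a i) = zero_sum_sets I a"
  by (simp add: zero_sum_sets_def sum_negf)

text \<open>Putting \<open>i\<close> into \<open>J\<close> adds \<open>i\<close> to the symmetric
  difference with \<open>?N\<close> if \<open>a i\<close> is not negative and removes it otherwise;
  either way the weight changes by \<open>a i\<close>. For empty \<open>J\<close> it is the weight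
  of \<open>?N\<close>, so zero sum means exactly this weight.\<close>

lemma card_zero_sum_sets_eq:
  assumes "finite I"
  shows "card (zero_sum_sets I a) =
    card {K. K \<subseteq> I \<and> (\<Sum>i\<in>K. \<bar>a i\<bar>) = (\<Sum>i | i \<in> I \<and> a i < 0. \<bar>a i\<bar>)}"
proof -
  let ?N = "{i \<in> I. a i < 0}"
  have *: "(\<Sum>i\<in>sym_diff J ?N. \<bar>a i\<bar>) = sum a J + (\<Sum>i\<in>?N. \<bar>a i\<bar>)" if "J \<subseteq> I" for J
  proof -
    have fin: "finite J" "finite ?N" using assms that finite_subset by auto
    have "(\<Sum>i\<in>sym_diff J ?N. \<bar>a i\<bar>) = (\<Sum>i\<in>J - ?N. \<bar>a i\<bar>) + (\<Sum>i\<in>?N - J. \<bar>a i\<bar>)"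
      using fin by (intro sum.union_disjoint) auto
    moreover have "(\<Sum>i\<in>J - ?N. \<bar>a i\<bar>) = sum a (J - ?N)"
      using that by (intro sum.cong) auto
    moreover have "(\<Sum>i\<in>J \<inter> ?N. \<bar>a i\<bar>) = - sum a (J \<inter> ?N)"
      unfolding sum_negf[symmetric] by (intro sum.cong) auto
    moreover have "sum a J = sum a (J \<inter> ?N) + sum a (J - ?N)"
      using fin(1) by (rule sum.Int_Diff)
    moreover have "(\<Sum>i\<in>?N. \<bar>a i\<bar>) = (\<Sum>i\<in>?N \<inter> J. \<bar>a i\<bar>) + (\<Sum>i\<in>?N - J. \<bar>a i\<bar>)"
      using fin(2) by (rule sum.Int_Diff)
    ultimately show ?thesis by (simp add: Int_commute)
  qed
  have invol: "sym_diff (sym_diff J ?N) ?N = J" for J by blast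
  have sub: "sym_diff J ?N \<subseteq> I" if "J \<subseteq> I" for J using that by blast
  have "bij_betw (\<lambda>J. sym_diff J ?N) (zero_sum_sets I a)
      {K. K \<subseteq> I \<and> (\<Sum>i\<in>K. \<bar>a i\<bar>) = (\<Sum>i\<in>?N. \<bar>a i\<bar>)}"
  proof (rule bij_betw_byWitness[where f' = "\<lambda>J. sym_diff J ?N"])
    show "(\<lambda>J. sym_diff J ?N) ` zero_sum_sets I a \<subseteq>
        {K. K \<subseteq> I \<and> (\<Sum>i\<in>K. \<bar>a i\<bar>) = (\<Sum>i\<in>?N. \<bar>a i\<bar>)}"
    proof (intro subsetI CollectI, elim imageE, goal_cases)
      case (1 K J)
      then show ?case using *[of J] sub[of J] by (simp add: zero_sum_sets_def)
    qed
    show "(\<lambda>J. sym_diff J ?N) ` {K. K \<subseteq> I \<and> (\<Sum>i\<in>K. \<bar>a i\<bar>) = (\<Sum>i\<in>?N. \<bar>a i\<bar>)} \<subseteq>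
        zero_sum_sets I a"
    proof (intro subsetI, elim imageE, goal_cases)
      case (1 J K)
      then have K: "K \<subseteq> I" "(\<Sum>i\<in>K. \<bar>a i\<bar>) = (\<Sum>i\<in>?N. \<bar>a i\<bar>)" by auto
      have "sum a (sym_diff K ?N) = 0" using *[OF sub[OF K(1)]] K(2) unfolding invol by simp
      then show ?case using 1(1) sub[OF K(1)] by (simp add: zero_sum_sets_def)
    qed
  qed (use invol in blast)+
  then show ?thesis by (rule bij_betw_same_card)
qed

text \<open>Positive and negative parts balance, so the negative part carries half of the total
  weight: \<open>\<bar>a i\<bar> - a i\<close> vanishes at positive entries and doubles the weight
  at negative ones.\<close>

lemma half_arcs_weights_abs:
  assumes "\<And>i. i \<in> I \<Longrightarrow> a i \<noteq> 0" "sum a I = 0" "bij_betw h {..<k} I"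
  shows "half_arcs_weights I (\<lambda>i. \<bar>a i\<bar>) k (\<Sum>i | i \<in> I \<and> a i < 0. \<bar>a i\<bar>) h"
proof
  have fin: "finite I" using assms(3) bij_betw_finite by blast
  have "(\<Sum>i\<in>I. \<bar>a i\<bar>) = (\<Sum>i\<in>I. \<bar>a i\<bar> - a i)"
    using assms(2) by (simp add: sum_subtractf)
  also have "\<dots> = (\<Sum>i | i \<in> I \<and> a i < 0. \<bar>a i\<bar> - a i)"
    using fin by (intro sum.mono_neutral_right) auto
  also have "\<dots> = 2 * (\<Sum>i | i \<in> I \<and> a i < 0. \<bar>a i\<bar>)"
    unfolding sum_distrib_left by (intro sum.cong) auto
  finally show "(\<Sum>i\<in>I. \<bar>a i\<bar>) = 2 * (\<Sum>i | i \<in> I \<and> a i < 0. \<bar>a i\<bar>)" .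
qed (use assms in auto)

lemma card_zero_sum_sets_le:
  assumes fin: "finite I" and k: "2 \<le> card I"
    and nz: "\<And>i. i \<in> I \<Longrightarrow> a i \<noteq> 0" and zero: "sum a I = 0"
  shows "card (zero_sum_sets I a) \<le> factor_poset_bound (card I)"
proof -
  obtain h where h: "bij_betw h {..<card I} I"
    using ex_bij_betw_nat_finite[OF fin] by (auto simp: lessThan_atLeast0)
  interpret half_arcs_weights I "\<lambda>i. \<bar>a i\<bar>" "card I" "\<Sum>i | i \<in> I \<and> a i < 0. \<bar>a i\<bar>" h
    using nz zero h by (rule half_arcs_weights_abs)
  have "card (zero_sum_sets I a) * card I \<le> factor_poset_bound (card I) * card I"
    using card_half_sets(1) k unfolding card_zero_sum_sets_eq[OF fin] half_sets_def
      factor_poset_bound_times[OF k] by fastforce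
  then show ?thesis using k by simp
qed

text \<open>
  Enumerate the indices of negative sign first. The halving arcs then start in the negative block and
  end in the other one, and two consecutive ones differ by a zero-sum set consisting of one negative
  element and the elements between their end points. If there were as many as \<open>k div 2\<close> such arcs,
  the end points would be at distance at least \<open>2\<close> from each other and not fit into the second block.
\<close>

lemma card_zero_sum_sets_less_aux:
  assumes fin: "finite I" and k: "4 \<le> card I"
    and nz: "\<And>i. i \<in> I \<Longrightarrow> a i \<noteq> 0" and zero: "sum a I = 0"
    and large: "\<And>J. J \<in> zero_sum_sets I a \<Longrightarrow> J \<noteq> {} \<Longrightarrow> 3 \<le> card J"
    and neg: "card {i \<in> I. a i < 0} \<le> card I div 2"
  shows "card (zero_sum_sets I a) < factor_poset_bound (card I)"
proof -
  define N where "N = {i \<in> I. a i < 0}"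
  define m where "m = card N"
  let ?k = "card I" and ?b = "\<lambda>i. \<bar>a i\<bar>"
  define t where "t = sum ?b N"
  have N: "N \<subseteq> I" "m \<le> ?k" using fin by (auto simp: N_def m_def intro: card_mono)
  obtain h0 where h0: "bij_betw h0 {..<?k} I"
    using ex_bij_betw_nat_finite[OF fin] by (auto simp: lessThan_atLeast0)
  have "{..<m} \<subseteq> {..<?k}" using N by auto
  then have "h0 ` {..<m} \<subseteq> I" "card (h0 ` {..<m}) = card N"
    using h0 by (auto simp: bij_betw_def card_image inj_on_subset m_def)
  then obtain p where p: "p permutes I" "p ` h0 ` {..<m} = N"
    using ex_permutes_image_eq[OF fin _ N(1)] by metis
  define h where "h = p \<circ> h0"
  have h: "bij_betw h {..<?k} I"
    unfolding h_def using h0 permutes_imp_bij[OF p(1)] by (rule bij_betw_trans)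
  have hN: "h ` {..<m} = N" using p(2) by (simp add: h_def image_comp)
  interpret half_arcs_weights I ?b ?k t h
    unfolding t_def N_def using nz zero h by (rule half_arcs_weights_abs)
  let ?M = "half_arcs ?b ?k t h"
  have h_N: "h j \<in> N \<longleftrightarrow> j < m" if "j < ?k" for j
  proof
    assume "h j \<in> N"
    then obtain i where "i < m" "h j = h i" using hN by (metis imageE lessThan_iff)
    then have "j = i" using h that N(2) by (auto simp: bij_betw_def inj_on_def)
    with \<open>i < m\<close> show "j < m" by simp
  qed (use hN in auto)
  have Bm: "B m = t"
    using sum_arc[of 0 m] N(2) hN by (simp add: B_0 t_def lessThan_atLeast0)
  have "card ?M < ?k div 2"
  proof (rule ccontr)
    assume "\<not> card ?M < ?k div 2"
    then have M: "m \<le> card ?M" "?k div 2 \<le> card ?M" using neg by (auto simp: m_def N_def)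
    have "fst q < m" if "q \<in> ?M" for q
    proof -
      obtain s e where q: "q = (s, e)" by fastforce
      with that have "B s < B m" "s < ?k" using half_arcs_D(1,2,4)[of s e] Bm by auto
      then show ?thesis using B_less_iff[of s m] N(2) q by simp
    qed
    then have "fst ` ?M \<subseteq> {..<m}" by auto
    moreover have "card (fst ` ?M) = card ?M" by (rule card_image) (rule inj_on_fst_half_arcs)
    \<comment> \<open>By \<open>neg\<close> there are at least \<open>m\<close> arcs, and their
      distinct starts all lie below \<open>m\<close>; so every \<open>s < m\<close> is a
      start.\<close>
    ultimately have "card ?M = m" "fst ` ?M = {..<m}"
      using card_mono[of "{..<m}" "fst ` ?M"] card_seteq[of "{..<m}" "fst ` ?M"] M by auto
    then have half: "?k div 2 \<le> m" using M(2) by simp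
    have "\<exists>e. (s, e) \<in> ?M" if "s < m" for s
    proof -
      have "s \<in> fst ` ?M" using \<open>fst ` ?M = {..<m}\<close> that by simp
      then show ?thesis by force
    qed
    then obtain e where e: "\<And>s. s < m \<Longrightarrow> (s, e s) \<in> ?M" by (metis lessThan_iff)
    \<comment> \<open>The value \<open>E m = ?k\<close> extends the pattern by one: the second block
      \<open>{m..<?k}\<close> also has weight \<open>t\<close>.\<close>
    define E where "E s = (if s < m then e s else ?k)" for s
    have B_E: "B (E s) = B s + t" if "s \<le> m" for s
      using half_arcs_D(3)[OF e, of s] that Bm B_k by (auto simp: E_def)
    have E_le: "E s \<le> ?k" for s
      using half_arcs_D(2)[OF e, of s] by (auto simp: E_def intro: less_imp_le)
    have m_le: "m \<le> E s" for s
    proof (cases "s < m")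
      case True
      then have "\<not> B (E s) < B m" using half_arcs_D(5)[OF e, of s] Bm by (simp add: E_def)
      then show ?thesis using B_less_iff[OF E_le N(2)] by simp
    qed (simp add: E_def N(2))
    have step: "E s + 2 \<le> E (Suc s)" if "s < m" for s
    proof -
      have "B (E s) < B (E (Suc s))" using that N(2) B_less[of s "Suc s"] by (simp add: B_E)
      then have less: "E s < E (Suc s)" using B_less_iff E_le by blast
      \<comment> \<open>Moving the start from \<open>s\<close> to \<open>Suc s\<close> loses the
        weight of \<open>h s\<close>, and the positive entries in \<open>?A\<close> make up for it.
        Together they form a zero-sum set, so by \<open>large\<close> there are at least two of
        them.\<close>
      let ?A = "{E s..<E (Suc s)}"
      have sub: "insert s ?A \<subseteq> {..<?k}" using that N(2) E_le[of "Suc s"] by auto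
      have inj: "inj_on h (insert s ?A)" "h ` insert s ?A \<subseteq> I"
        using inj_on_subset[OF bij_betw_imp_inj_on[OF h] sub] image_mono[OF sub, of h]
        by (simp_all only: bij_betw_imp_surj_on[OF h])
      have s: "s \<notin> ?A" using that m_le[of s] by auto
      have "sum a (h ` ?A) = sum ?b (h ` ?A)"
      proof (intro sum.cong refl)
        fix i assume "i \<in> h ` ?A"
        then obtain j where j: "j \<in> ?A" "i = h j" by auto
        then have "j < ?k" "\<not> j < m" using E_le[of "Suc s"] m_le[of s] by auto
        then have "i \<notin> N" "i \<in> I" using h_N[of j] h_in[of j] j by auto
        then show "a i = \<bar>a i\<bar>" by (simp add: N_def)
      qed
      also have "\<dots> = B (Suc s) - B s"
        using sum_arc[of "E s" "E (Suc s)"] less E_le[of "Suc s"] that by (simp add: B_E)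
      also have "\<dots> = - a (h s)"
      proof -
        have "h s \<in> N" using that h_N[of s] N(2) by simp
        then show ?thesis by (simp add: B_def N_def)
      qed
      finally have A: "sum a (h ` ?A) = - a (h s)" .
      have "sum a (h ` insert s ?A) = a (h s) + sum a (h ` ?A)"
        using s inj(1) by (subst image_insert, subst sum.insert) auto
      then have "h ` insert s ?A \<in> zero_sum_sets I a"
        using A inj(2) by (simp add: zero_sum_sets_def)
      then have "3 \<le> card (h ` insert s ?A)" using large by blast
      then show ?thesis using s less by (simp only: card_image[OF inj(1)]) simp
    qed
    have "s \<le> m \<Longrightarrow> m + 2 * s \<le> E s" for s
    proof (induction s)
      case 0
      then show ?case using m_le by simp
    next
      case (Suc s)
      then show ?case using step[of s] by simp
    qed
    \<comment> \<open>With \<open>?k div 2 \<le> m\<close> this is impossible from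
      \<open>?k = 4\<close> on; \<open>m = 1\<close>, \<open>?k = 3\<close> would be
      consistent.\<close>
    from this[of m] have "3 * m \<le> ?k" by (simp add: E_def)
    then show False using half k by presburger
  qed
  moreover have "I \<noteq> {}" using k by auto
  moreover have "card (zero_sum_sets I a) = card half_sets"
    by (simp only: card_zero_sum_sets_eq[OF fin] half_sets_def t_def[symmetric] N_def[symmetric])
  ultimately have "card (zero_sum_sets I a) * ?k < factor_poset_bound ?k * ?k"
    using card_half_sets(2) k factor_poset_bound_times[of ?k] by simp
  then show ?thesis by simp
qed

text \<open>Negating \<open>a\<close> keeps the zero-sum sets and swaps the signs, so the negative
  entries may be assumed to be at most half of all.\<close>

lemma card_zero_sum_sets_less:
  assumes fin: "finite I" and k: "4 \<le> card I"
    and nz: "\<And>i. i \<in> I \<Longrightarrow> a i \<noteq> 0" and zero: "sum a I = 0"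
    and large: "\<And>J. J \<in> zero_sum_sets I a \<Longrightarrow> J \<noteq> {} \<Longrightarrow> 3 \<le> card J"
  shows "card (zero_sum_sets I a) < factor_poset_bound (card I)"
proof (cases "card {i \<in> I. a i < 0} \<le> card I div 2")
  case True
  then show ?thesis using card_zero_sum_sets_less_aux assms by blast
next
  case False
  have "{i \<in> I. - a i < 0} = I - {i \<in> I. a i < 0}" using nz by force
  then have "card {i \<in> I. - a i < 0} = card I - card {i \<in> I. a i < 0}"
    using fin by (simp add: card_Diff_subset)
  then have "card {i \<in> I. - a i < 0} \<le> card I div 2" using False by linarith
  then show ?thesis
    using card_zero_sum_sets_less_aux[of I "\<lambda>i. - a i"] assms
    unfolding zero_sum_sets_uminus by (simp add: sum_negf)
qed

subsection \<open>Factors of a tight frame\<close>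

text \<open>Induction on \<open>I\<close>: if \<open>u\<close> is nonzero on \<open>I\<close> and
  \<open>v\<close> at the new index, each index rules out at most one \<open>c\<close> for
  \<open>u + c * v\<close>, and there are infinitely many reals.\<close>

lemma ex_combination_nonzero_on:
  fixes W :: "('i \<Rightarrow> real) set"
  assumes "finite I" "W \<noteq> {}"
    and comb: "\<And>u v c. u \<in> W \<Longrightarrow> v \<in> W \<Longrightarrow> (\<lambda>i. u i + c * v i) \<in> W"
    and nz: "\<And>i. i \<in> I \<Longrightarrow> \<exists>u\<in>W. u i \<noteq> 0"
  shows "\<exists>u\<in>W. \<forall>i\<in>I. u i \<noteq> 0"
  using assms(1) nz
proof (induction I rule: finite_induct)
  case empty
  then show ?case using assms(2) by blast
next
  case (insert x I)
  then obtain u where u: "u \<in> W" "\<forall>i\<in>I. u i \<noteq> 0" by auto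
  obtain v where v: "v \<in> W" "v x \<noteq> 0" using insert.prems by auto
  obtain c where c: "c \<notin> (\<lambda>i. - u i / v i) ` insert x I"
    using ex_new_if_finite[OF infinite_UNIV_char_0[where 'a = real]] insert.hyps(1)
    by (metis finite_imageI finite_insert)
  have "u i + c * v i \<noteq> 0" if "i \<in> insert x I" for i
  proof (cases "v i = 0")
    case True
    then show ?thesis using that u(2) v(2) by auto
  next
    case False
    have "c \<noteq> - u i / v i" using c that by blast
    then have "c * v i \<noteq> - u i" by (simp only: nonzero_eq_divide_eq[OF False] not_False_eq_True)
    then show ?thesis by linarith
  qed
  then show ?case using comb[OF u(1) v(1), of c] by (intro bexI[of _ "\<lambda>i. u i + c * v i"]) auto
qed

text \<open>
  All that is used of the two inner products: their absolute values on the diagonal and against the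
  coordinate axes.
\<close>

locale coordinate_product =
  fixes ip :: "'a::real_normed_field ^ 'n \<Rightarrow> 'a ^ 'n \<Rightarrow> 'a"
  assumes norm_self: "norm (ip x x) = (norm x)\<^sup>2"
    and norm_axis_left: "norm (ip (axis l c) y) = norm c * norm (y $ l)"
    and norm_axis_right: "norm (ip x (axis l c)) = norm (x $ l) * norm c"
begin

text \<open>Compare \<open>z\<close> with an axis vector of the same norm. The products with
  \<open>z\<close> have moduli \<open>(norm z)\<^sup>2\<close> and
  \<open>norm z * norm (z $ l)\<close>, and in dimension at least two some coordinate
  \<open>l\<close> has modulus different from \<open>norm z\<close>.\<close>

lemma ex_equal_norm_different_product:
  assumes "CARD('n) \<ge> 2" "z \<noteq> 0"
  obtains x y where "norm x = norm y" "norm (ip x z) \<noteq> norm (ip y z)"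
proof -
  have sq: "(norm z)\<^sup>2 = (\<Sum>l\<in>UNIV. (norm (z $ l))\<^sup>2)"
    by (simp add: norm_vec_def L2_set_def sum_nonneg)
  have "\<not> (\<forall>i j :: 'n. i = j)"
  proof
    assume "\<forall>i j :: 'n. i = j"
    then have "CARD('n) \<le> 1" by (simp add: card_le_Suc0_iff_eq)
    with assms(1) show False by simp
  qed
  then obtain i j :: 'n where ij: "i \<noteq> j" by blast
  have "(\<Sum>l\<in>{i, j}. (norm (z $ l))\<^sup>2) \<le> (norm z)\<^sup>2"
    unfolding sq by (rule sum_mono2) auto
  then have "(norm (z $ i))\<^sup>2 + (norm (z $ j))\<^sup>2 \<le> (norm z)\<^sup>2" using ij by simp
  moreover have "norm z > 0" using assms(2) by simp
  ultimately have "norm (z $ i) \<noteq> norm z \<or> norm (z $ j) \<noteq> norm z"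
    by (smt (verit) zero_less_power)
  then obtain l where l: "norm (z $ l) \<noteq> norm z" by blast
  have "norm (axis l (of_real (norm z)) :: 'a ^ 'n) = norm z"
    by (simp add: norm_vec_def L2_set_def sum_nonneg axis_def if_distrib[where f = norm] if_distrib[where f = "\<lambda>x. x\<^sup>2"] cong: if_cong)
  moreover have "norm (ip (axis l (of_real (norm z))) z) \<noteq> norm (ip z z)"
    using l assms(2) by (simp add: norm_self norm_axis_left power2_eq_square)
  ultimately show ?thesis using that[of z "axis l (of_real (norm z))"] by metis
qed

text \<open>The functions with zero sum over every factor are closed under linear combinations. For
  each \<open>i\<close>, two vectors of equal norm that \<open>f i\<close> distinguishes give one
  that is nonzero at \<open>i\<close>, since the frame constant cancels; a generic combination then
  serves all indices.\<close>

lemma factor_poset_subset_zero_sum_sets: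
  assumes n: "CARD('n) \<ge> 2" and fin: "finite I" and nz: "\<And>i. i \<in> I \<Longrightarrow> f i \<noteq> 0"
  obtains a where "factor_poset ip I f \<subseteq> zero_sum_sets I a" "\<And>i. i \<in> I \<Longrightarrow> a i \<noteq> 0"
proof -
  define W where "W = {a :: _ \<Rightarrow> real. \<forall>J\<in>factor_poset ip I f. sum a J = 0}"
  have "\<exists>a\<in>W. \<forall>i\<in>I. a i \<noteq> 0"
  proof (rule ex_combination_nonzero_on[OF fin])
    have "(\<lambda>_. 0) \<in> W" by (simp add: W_def)
    then show "W \<noteq> {}" by blast
    show "(\<lambda>i. u i + c * v i) \<in> W" if "u \<in> W" "v \<in> W" for u v c
      using that by (simp add: W_def sum.distrib flip: sum_distrib_left)
    fix i assume "i \<in> I"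
    then obtain x y where xy: "norm x = norm y" "norm (ip x (f i)) \<noteq> norm (ip y (f i))"
      using ex_equal_norm_different_product[OF n nz] by metis
    let ?a = "\<lambda>j. (norm (ip x (f j)))\<^sup>2 - (norm (ip y (f j)))\<^sup>2"
    have "sum ?a J = 0" if "J \<in> factor_poset ip I f" for J
    proof (cases "J = {}")
      case False
      then have "is_tight_frame ip J f" using that by (simp add: factor_poset_def)
      then obtain c where "\<forall>x. (\<Sum>i\<in>J. (norm (ip x (f i)))\<^sup>2) = c * (norm x)\<^sup>2"
        unfolding is_tight_frame_def by blast
      then show ?thesis using xy(1) by (simp add: sum_subtractf)
    qed simp
    then have "?a \<in> W" by (simp add: W_def)
    then show "\<exists>a\<in>W. a i \<noteq> 0" using xy(2) by (intro bexI[of _ ?a]) auto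
  qed
  then obtain a where "a \<in> W" "\<forall>i\<in>I. a i \<noteq> 0" by blast
  moreover from this have "factor_poset ip I f \<subseteq> zero_sum_sets I a"
    by (auto simp: W_def zero_sum_sets_def factor_poset_def)
  ultimately show ?thesis using that by blast
qed

end

section \<open>Bounds for the factor poset of a frame\<close>

lemma tight_frame_in_factor_poset: "is_tight_frame ip I f \<Longrightarrow> I \<in> factor_poset ip I f"
  by (simp add: factor_poset_def)

lemma is_tight_frame_card:
  fixes f :: "'i \<Rightarrow> 'a::real_normed_field ^ 'n"
  assumes "is_tight_frame ip J f"
  shows "CARD('n) \<le> card J"
proof -
  have J: "finite J" "vec.span (f ` J) = UNIV"
    using assms by (auto simp: is_tight_frame_def is_frame_def)
  have "vec.dim (UNIV :: ('a ^ 'n) set) \<le> card (f ` J)"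
    using J by (intro vec.dim_le_card) auto
  also have "\<dots> \<le> card J" using J(1) by (rule card_image_le)
  finally show ?thesis unfolding vec_dim_card .
qed

context coordinate_product
begin

lemma card_factor_poset_le:
  assumes n: "CARD('n) \<ge> 2" and tight: "is_tight_frame ip I f" and nz: "\<And>i. i \<in> I \<Longrightarrow> f i \<noteq> 0"
  shows "card (factor_poset ip I f) \<le> factor_poset_bound (card I)"
proof -
  have fin: "finite I" using tight by (simp add: is_tight_frame_def is_frame_def)
  obtain a where a: "factor_poset ip I f \<subseteq> zero_sum_sets I a" "\<And>i. i \<in> I \<Longrightarrow> a i \<noteq> 0"
    using factor_poset_subset_zero_sum_sets[OF n fin, of f] nz by metis
  have "card (factor_poset ip I f) \<le> card (zero_sum_sets I a)"
    using finite_zero_sum_sets[OF fin] a(1) by (rule card_mono)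
  also have "\<dots> \<le> factor_poset_bound (card I)"
    using tight_frame_in_factor_poset[OF tight] a is_tight_frame_card[OF tight] n
    by (intro card_zero_sum_sets_le fin) (auto simp: zero_sum_sets_def)
  finally show ?thesis .
qed

text \<open>Either some zero-sum set is not a factor, and the general bound is already strict, or
  every nonempty zero-sum set is a tight frame and so has at least three elements, as
  \<open>card_zero_sum_sets_less\<close> requires.\<close>

lemma card_factor_poset_less:
  assumes n: "CARD('n) \<ge> 3" and k: "card I \<noteq> 3"
    and tight: "is_tight_frame ip I f" and nz: "\<And>i. i \<in> I \<Longrightarrow> f i \<noteq> 0"
  shows "card (factor_poset ip I f) < factor_poset_bound (card I)"
proof -
  have fin: "finite I" using tight by (simp add: is_tight_frame_def is_frame_def)
  have k4: "card I \<ge> 4" using is_tight_frame_card[OF tight] n k by simp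
  have n2: "CARD('n) \<ge> 2" using n by simp
  obtain a where a: "factor_poset ip I f \<subseteq> zero_sum_sets I a" "\<And>i. i \<in> I \<Longrightarrow> a i \<noteq> 0"
    using factor_poset_subset_zero_sum_sets[OF n2 fin, of f] nz by metis
  have zero: "sum a I = 0"
    using tight_frame_in_factor_poset[OF tight] a(1) by (auto simp: zero_sum_sets_def)
  show ?thesis
  proof (cases "factor_poset ip I f = zero_sum_sets I a")
    case True
    have "3 \<le> card J" if "J \<in> zero_sum_sets I a" "J \<noteq> {}" for J
      using that n is_tight_frame_card[of ip J f] unfolding True[symmetric]
      by (auto simp: factor_poset_def)
    then show ?thesis unfolding True using card_zero_sum_sets_less[OF fin k4 a(2) zero] by blast
  next
    case False
    then have "card (factor_poset ip I f) < card (zero_sum_sets I a)"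
      using a(1) finite_zero_sum_sets[OF fin] by (intro psubset_card_mono) auto
    also have "\<dots> \<le> factor_poset_bound (card I)"
      using card_zero_sum_sets_le[OF fin _ a(2) zero] k4 by simp
    finally show ?thesis .
  qed
qed

lemma not_factor_poset_bound_attained:
  assumes "CARD('n) \<ge> 3" "k \<noteq> 3"
  shows "\<not> factor_poset_bound_attained ip k"
  proof
  assume "factor_poset_bound_attained ip k"
  then obtain f :: "nat \<Rightarrow> 'a ^ 'n" where "is_tight_frame ip {..<k} f" "\<forall>i<k. f i \<noteq> 0"
      and eq: "card (factor_poset ip {..<k} f) = factor_poset_bound k"
    unfolding factor_poset_bound_attained_def by blast
  then have "card (factor_poset ip {..<k} f) < factor_poset_bound (card {..<k})"
    using assms by (intro card_factor_poset_less) auto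
  with eq show False by simp
qed

text \<open>
  In dimension two, vectors on the two coordinate axes with squared lengths \<open>\<bar>a i\<bar>\<close>, the sign of \<open>a i\<close>
  selecting the axis, have exactly the zero-sum sets of \<open>a\<close> as factors.
\<close>

lemma factor_poset_axis:
  assumes n: "CARD('n) = 2" and fin: "finite I" and nz: "\<And>i. i \<in> I \<Longrightarrow> a i \<noteq> 0"
  obtains f where "\<And>i. i \<in> I \<Longrightarrow> f i \<noteq> 0" "factor_poset ip I f = zero_sum_sets I a"
proof -
  obtain u v :: 'n where uv: "(UNIV :: 'n set) = {u, v}" "u \<noteq> v"
    using n by (auto simp: card_2_iff)
  define f :: "_ \<Rightarrow> 'a ^ 'n" where
    "f i = axis (if a i > 0 then u else v) (of_real (sqrt \<bar>a i\<bar>))" for i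
  have f0: "f i \<noteq> 0" if "i \<in> I" for i
    using nz[OF that] by (auto simp: f_def axis_eq_0_iff)
  have norm2: "(norm x)\<^sup>2 = (norm (x $ u))\<^sup>2 + (norm (x $ v))\<^sup>2" for x :: "'a ^ 'n"
    using uv(2) by (simp add: norm_vec_def L2_set_def uv(1))
  have frame: "(\<Sum>i\<in>J. (norm (ip x (f i)))\<^sup>2) =
      (norm (x $ u))\<^sup>2 * (\<Sum>i | i \<in> J \<and> a i > 0. \<bar>a i\<bar>) +
      (norm (x $ v))\<^sup>2 * (\<Sum>i | i \<in> J \<and> \<not> a i > 0. \<bar>a i\<bar>)" if "J \<subseteq> I" for J x
  proof -
    have "finite J" using that fin finite_subset by blast
    have "(norm (ip x (f i)))\<^sup>2 =
        (if a i > 0 then (norm (x $ u))\<^sup>2 * \<bar>a i\<bar> else (norm (x $ v))\<^sup>2 * \<bar>a i\<bar>)" for i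
      by (simp add: f_def norm_axis_right power_mult_distrib)
    then show ?thesis
      using \<open>finite J\<close> by (simp add: sum.If_cases sum_distrib_left Int_def)
  qed
  have sum_a: "sum a J = (\<Sum>i | i \<in> J \<and> a i > 0. \<bar>a i\<bar>) - (\<Sum>i | i \<in> J \<and> \<not> a i > 0. \<bar>a i\<bar>)"
    if "J \<subseteq> I" for J
  proof -
    have "finite J" using that fin finite_subset by blast
    have "sum a J = (\<Sum>i\<in>J. if a i > 0 then \<bar>a i\<bar> else - \<bar>a i\<bar>)"
      by (intro sum.cong) auto
    also have "\<dots> = (\<Sum>i | i \<in> J \<and> a i > 0. \<bar>a i\<bar>) - (\<Sum>i | i \<in> J \<and> \<not> a i > 0. \<bar>a i\<bar>)"
      using \<open>finite J\<close> by (simp add: sum.If_cases sum_negf Int_def)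
    finally show ?thesis .
  qed
  have "J = {} \<or> is_tight_frame ip J f \<longleftrightarrow> sum a J = 0" if J: "J \<subseteq> I" for J
  proof (intro iffI)
    assume "J = {} \<or> is_tight_frame ip J f"
    then show "sum a J = 0"
    proof
      assume "is_tight_frame ip J f"
      then obtain c where c: "\<And>x. (\<Sum>i\<in>J. (norm (ip x (f i)))\<^sup>2) = c * (norm x)\<^sup>2"
        by (auto simp: is_tight_frame_def)
      \<comment> \<open>At the two unit axis vectors the frame identity says that both axes carry
        the same total weight \<open>c\<close>.\<close>
      show ?thesis
        using c[of "axis u 1"] c[of "axis v 1"] uv(2)
        unfolding frame[OF J] sum_a[OF J] norm2 by (simp add: axis_def)
    qed simp
  next
    assume zero: "sum a J = 0"
    show "J = {} \<or> is_tight_frame ip J f"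
    proof (cases "J = {}")
      case False
      have finJ: "finite J" using J fin finite_subset by blast
      define c where "c = (\<Sum>i | i \<in> J \<and> a i > 0. \<bar>a i\<bar>)"
      have c': "(\<Sum>i | i \<in> J \<and> \<not> a i > 0. \<bar>a i\<bar>) = c"
        using zero unfolding sum_a[OF J] c_def by simp
      have "0 < (\<Sum>i\<in>J. \<bar>a i\<bar>)" using finJ False nz J by (intro sum_pos) auto
      also have "\<dots> = (\<Sum>i\<in>J \<inter> {i. a i > 0}. \<bar>a i\<bar>) + (\<Sum>i\<in>J - {i. a i > 0}. \<bar>a i\<bar>)"
        using finJ by (rule sum.Int_Diff)
      also have "\<dots> = 2 * c"
        using c' by (simp add: c_def Int_def set_diff_eq)
      finally have c: "c > 0" by simp
      \<comment> \<open>Both axes carry weight \<open>c > 0\<close>, so each is occupied by some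
        vector of the subfamily; this gives the spanning property.\<close>
      have "{i \<in> J. a i > 0} \<noteq> {}" "{i \<in> J. \<not> a i > 0} \<noteq> {}"
        using c c' by (metis c_def less_irrefl sum.empty)+
      then obtain i j where i: "i \<in> J" "a i > 0" and j: "j \<in> J" "\<not> a j > 0" by blast
      have ax: "axis l 1 \<in> vec.span (f ` J)"
        if "i \<in> J" "f i = axis l (of_real (sqrt \<bar>a i\<bar>))" for l i
      proof -
        have "a i \<noteq> 0" using that(1) J nz by blast
        then have "axis l 1 = inverse (of_real (sqrt \<bar>a i\<bar>)) *s f i"
          using that(2) by (auto simp: vec_eq_iff axis_def)
        moreover have "f i \<in> vec.span (f ` J)" using that(1) by (intro vec.span_base) simp
        ultimately show ?thesis by (simp add: vec.span_scale)
      qed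
      have "axis u 1 \<in> vec.span (f ` J)" "axis v 1 \<in> vec.span (f ` J)"
        using ax[OF i(1), of u] ax[OF j(1), of v] i j by (auto simp: f_def)
      then have "axis l 1 \<in> vec.span (f ` J)" for l
        using uv(1) UNIV_I[of l] by auto
      then have "cart_basis \<subseteq> vec.span (f ` J)" by (auto simp: cart_basis_def)
      then have "vec.span (f ` J) = UNIV"
        using vec.span_minimal[OF _ vec.subspace_span] span_cart_basis by blast
      moreover have "(\<Sum>i\<in>J. (norm (ip x (f i)))\<^sup>2) = c * (norm x)\<^sup>2" for x
        unfolding frame[OF J] norm2 c' c_def[symmetric] by (simp add: algebra_simps)
      ultimately show ?thesis
        using finJ c by (auto simp: is_tight_frame_def is_frame_def)
    qed simp
  qed
  then have "factor_poset ip I f = zero_sum_sets I a"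
    by (auto simp: factor_poset_def zero_sum_sets_def)
  with f0 show ?thesis using that by blast
qed

end

section \<open>Equality in dimension two\<close>

text \<open>For even \<open>k\<close>, equally many weights \<open>1\<close> and \<open>-1\<close>
  make the half-weight sets those of middle size. For \<open>k = 2 * m + 1\<close>, one of the
  \<open>m\<close> positive weights is raised to \<open>2\<close> against \<open>m + 1\<close>
  negative ones. Half of the total is \<open>m + 1\<close>, reached by \<open>m + 1\<close> unit
  weights, or by the double one and \<open>m - 1\<close> unit weights.\<close>

lemma ex_card_zero_sum_sets_eq:
  assumes k: "2 \<le> k"
  obtains a :: "nat \<Rightarrow> real" where "\<And>i. a i \<noteq> 0" "sum a {..<k} = 0"
    "card (zero_sum_sets {..<k} a) = factor_poset_bound k"
proof -
  define m where "m = k div 2"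
  have m: "0 < m" "m < k" "k = (if even k then 2 * m else Suc (2 * m))"
    using k by (auto simp: m_def)
  define a :: "nat \<Rightarrow> real" where
    "a i = (if i < m then if i = 0 \<and> odd k then 2 else 1 else - 1)" for i
  have N: "{i \<in> {..<k}. a i < 0} = {m..<k}" by (auto simp: a_def)
  have "(\<Sum>i\<in>{m..<k}. \<bar>a i\<bar>) = (\<Sum>i\<in>{m..<k}. 1)"
    by (intro sum.cong) (auto simp: a_def)
  then have T: "(\<Sum>i\<in>{m..<k}. \<bar>a i\<bar>) = real (k - m)" by simp
  have weight: "(\<Sum>i\<in>K. \<bar>a i\<bar>) = real (card K + (if odd k \<and> 0 \<in> K then 1 else 0))"
    if "K \<subseteq> {..<k}" for K
  proof -
    have fin: "finite K" using that finite_subset by blast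
    have "(\<Sum>i\<in>K. \<bar>a i\<bar>) = (\<Sum>i\<in>K. 1 + (if i = 0 then of_bool (odd k) else 0))"
      using m(1) by (intro sum.cong) (auto simp: a_def)
    also have "\<dots> = real (card K) + (if 0 \<in> K then of_bool (odd k) else 0)"
      using fin by (simp only: sum.distrib sum.delta) simp
    finally show ?thesis by simp
  qed
  have card_eq: "card (zero_sum_sets {..<k} a) =
      card {K. K \<subseteq> {..<k} \<and> card K + (if odd k \<and> 0 \<in> K then 1 else 0) = k - m}"
    unfolding card_zero_sum_sets_eq[OF finite_lessThan] N T
    by (rule arg_cong[where f = card]) (auto simp only: weight of_nat_eq_iff)
  have "sum a {..<k} = (\<Sum>i\<in>{..<m}. \<bar>a i\<bar>) - (\<Sum>i\<in>{m..<k}. \<bar>a i\<bar>)"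
  proof -
    have "sum a {..<k} = sum a {..<m} + sum a {m..<k}"
      using m(2) by (metis less_imp_le_nat lessThan_atLeast0 sum.atLeastLessThan_concat zero_le)
    moreover have "sum a {..<m} = (\<Sum>i\<in>{..<m}. \<bar>a i\<bar>)"
      by (intro sum.cong) (auto simp: a_def)
    moreover have "sum a {m..<k} = - (\<Sum>i\<in>{m..<k}. \<bar>a i\<bar>)"
      unfolding sum_negf[symmetric] by (intro sum.cong) (auto simp: a_def)
    ultimately show ?thesis by simp
  qed
  then have "sum a {..<k} = 0"
    using T weight[of "{..<m}"] m by (auto split: if_splits)
  moreover have "card (zero_sum_sets {..<k} a) = factor_poset_bound k"
  proof (cases "even k")
    case True
    then have "k - m = k div 2" unfolding m_def by presburger
    then show ?thesis unfolding card_eq using True n_subsets[of "{..<k}" "k div 2"]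
      by (simp add: factor_poset_bound_def)
  next
    case False
    then have km: "k = Suc (2 * m)" using m by simp
    let ?P = "{1..<k}"
    have split: "{K. K \<subseteq> {..<k} \<and> card K + (if odd k \<and> 0 \<in> K then 1 else 0) = k - m} =
        {K. K \<subseteq> ?P \<and> card K = m + 1} \<union> insert 0 ` {K. K \<subseteq> ?P \<and> card K = m - 1}"
      (is "?L = ?A \<union> insert 0 ` ?B")
    proof (intro equalityI subsetI)
      fix K assume K: "K \<in> ?L"
      then have fin: "finite K" using finite_subset by blast
      show "K \<in> ?A \<union> insert 0 ` ?B"
      proof (cases "0 \<in> K")
        case True
        then have "K = insert 0 (K - {0})" "K - {0} \<subseteq> ?P" using K by (auto simp: Suc_le_eq)
        moreover have "card (K - {0}) = m - 1" using K True False fin km by (simp add: card_Diff_singleton)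
        ultimately show ?thesis by blast
      next
        case no: False
        have "K \<subseteq> ?P" using K no by (auto simp: Suc_le_eq intro: gr0I)
        then show ?thesis using K no km by simp
      qed
    next
      fix K assume "K \<in> ?A \<union> insert 0 ` ?B"
      then show "K \<in> ?L"
      proof
        assume "K \<in> ?A"
        then show ?thesis using km by auto
      next
        assume "K \<in> insert 0 ` ?B"
        then obtain K' where K': "K = insert 0 K'" "K' \<subseteq> ?P" "card K' = m - 1" by auto
        then have "finite K'" "0 \<notin> K'" using finite_subset by auto
        then have "card K = m" using K' m(1) by simp
        then show ?thesis using K' km by auto
      qed
    qed
    have "card (?A \<union> insert 0 ` ?B) = card ?A + card (insert 0 ` ?B)"
      by (intro card_Un_disjoint) auto
    also have "card (insert 0 ` ?B) = card ?B"
    proof (rule card_image, rule inj_onI)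
      fix K L assume "K \<in> ?B" "L \<in> ?B" "insert 0 K = insert 0 L"
      moreover from this have "0 \<notin> K" "0 \<notin> L" by auto
      ultimately show "K = L" by (metis insert_ident)
    qed
    also have "card ?A = (2 * m choose (m + 1))" using n_subsets[of ?P "m + 1"] km by simp
    also have "card ?B = (2 * m choose (m - 1))" using n_subsets[of ?P "m - 1"] km by simp
    \<comment> \<open>The two kinds of sets are equally numerous by symmetry, whence the factor
      \<open>2\<close> in the odd case of the bound.\<close>
    also have "2 * m choose (m + 1) = 2 * m choose (m - 1)"
      using binomial_symmetric[of "m + 1" "2 * m"] m(1) by simp
    finally show ?thesis unfolding card_eq split using False by (simp add: factor_poset_bound_def km)
  qed
  moreover have "a i \<noteq> 0" for i by (simp add: a_def)
  ultimately show ?thesis using that by blast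
qed

lemma (in coordinate_product) factor_poset_bound_attained:
  assumes "CARD('n) = 2" "2 \<le> k"
  shows "factor_poset_bound_attained ip k"
proof -
  obtain a :: "nat \<Rightarrow> real" where a: "\<And>i. a i \<noteq> 0" "sum a {..<k} = 0"
      "card (zero_sum_sets {..<k} a) = factor_poset_bound k"
    using ex_card_zero_sum_sets_eq[OF assms(2)] by blast
  obtain f where f: "\<And>i. i \<in> {..<k} \<Longrightarrow> f i \<noteq> 0" "factor_poset ip {..<k} f = zero_sum_sets {..<k} a"
    using factor_poset_axis[OF assms(1) finite_lessThan[of k], of a] a(1) by blast
  have "{..<k} \<in> factor_poset ip {..<k} f" unfolding f(2) using a(2) by (simp add: zero_sum_sets_def)
  moreover have "{..<k} \<noteq> {}" using assms(2) by (auto simp: lessThan_empty_iff)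
  ultimately have "is_tight_frame ip {..<k} f" unfolding factor_poset_def by blast
  then show ?thesis unfolding factor_poset_bound_attained_def using f a(3) by auto
qed

section \<open>The real and the Hermitian inner product\<close>

lemma coordinate_product_inner: "coordinate_product ((\<bullet>) :: real ^ 'n \<Rightarrow> real ^ 'n \<Rightarrow> real)"
  by standard (auto simp: power2_norm_eq_inner inner_axis inner_axis' abs_mult)

text \<open>Only moduli are compared, so the conjugation in the second argument leaves no
  trace.\<close>

lemma coordinate_product_hermitian_inner:
  "coordinate_product (hermitian_inner :: complex ^ 'n \<Rightarrow> complex ^ 'n \<Rightarrow> complex)"
proof
  fix x y :: "complex ^ 'n" and l c
  have "hermitian_inner x x = (\<Sum>i\<in>UNIV. of_real ((norm (x $ i))\<^sup>2))"
    unfolding hermitian_inner_def by (intro sum.cong refl) (simp only: complex_norm_square)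
  also have "\<dots> = of_real ((norm x)\<^sup>2)"
    by (simp add: norm_vec_def L2_set_def sum_nonneg)
  finally show "norm (hermitian_inner x x) = (norm x)\<^sup>2" by (simp add: norm_power)
  show "norm (hermitian_inner (axis l c) y) = norm c * norm (y $ l)"
    by (simp add: hermitian_inner_def axis_def if_distrib[where f = "\<lambda>z. z * _"] norm_mult cong: if_cong)
  show "norm (hermitian_inner x (axis l c)) = norm (x $ l) * norm c"
    by (simp add: hermitian_inner_def axis_def if_distrib[where f = cnj] if_distrib[where f = "\<lambda>z. _ * z"] norm_mult cong: if_cong)
qed

theorem corollary7:
  assumes "CARD('n::finite) \<ge> 2"
  shows "(\<forall>(I :: 'i set) (f :: 'i \<Rightarrow> real ^ 'n).
            is_tight_frame (\<bullet>) I f \<and> (\<forall>i\<in>I. f i \<noteq> 0) \<longrightarrow>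
            card (factor_poset (\<bullet>) I f) \<le> factor_poset_bound (card I)) \<and>
         (\<forall>(I :: 'i set) (f :: 'i \<Rightarrow> complex ^ 'n).
            is_tight_frame hermitian_inner I f \<and> (\<forall>i\<in>I. f i \<noteq> 0) \<longrightarrow>
            card (factor_poset hermitian_inner I f) \<le> factor_poset_bound (card I)) \<and>
         (CARD('n) = 2 \<longrightarrow>
            (\<forall>k\<ge>2. factor_poset_bound_attained ((\<bullet>) :: real ^ 'n \<Rightarrow> real ^ 'n \<Rightarrow> real) k \<and>
                   factor_poset_bound_attained
                     (hermitian_inner :: complex ^ 'n \<Rightarrow> complex ^ 'n \<Rightarrow> complex) k)) \<and>
         (CARD('n) \<ge> 3 \<longrightarrow>
            (\<forall>k. k \<noteq> 3 \<longrightarrow>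
               \<not> factor_poset_bound_attained ((\<bullet>) :: real ^ 'n \<Rightarrow> real ^ 'n \<Rightarrow> real) k \<and>
               \<not> factor_poset_bound_attained
                   (hermitian_inner :: complex ^ 'n \<Rightarrow> complex ^ 'n \<Rightarrow> complex) k))"
proof -
  interpret R: coordinate_product "(\<bullet>) :: real ^ 'n \<Rightarrow> real ^ 'n \<Rightarrow> real"
    by (rule coordinate_product_inner)
  interpret C: coordinate_product "hermitian_inner :: complex ^ 'n \<Rightarrow> complex ^ 'n \<Rightarrow> complex"
    by (rule coordinate_product_hermitian_inner)
  show ?thesis
    by (intro conjI allI impI; (elim conjE)?)
      (simp_all add: R.card_factor_poset_le[OF assms] C.card_factor_poset_le[OF assms]
        R.factor_poset_bound_attained C.factor_poset_bound_attained
        R.not_factor_poset_bound_attained C.not_factor_poset_bound_attained)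
qed

end
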